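(* Consider the heterogeneous networked system $\dot X(t)=FX(t)+GU(t)$ with $F=A+C\otimes H$, $G=D\otimes B$, $A=\mathrm{blockdiag}\{A_1,\ldots,A_N\}$. Suppose that there exists a node $j$ with no edges from any other nodes, i.e. the $j$-th row of the network topology matrix $C$ is zero. If $(A_j,B)$ is not controllable, then the networked system is not controllable.
   Context: The networked system has $N$ nodes, each of dimension $n$: $\dot x_i(t)=A_ix_i(t)+\sum_{j=1}^Nc_{ij}Hx_j(t)+d_iBu_i(t)$, $i=1,\ldots,N$, where $x_i(t)\in\mathbb{R}^n$ is the state and $u_i(t)\in\mathbb{R}^m$ the external control input of node $i$, $A_i\in\mathbb{R}^{n\times n}$ is the state matrix of node $i$, $B\in\mathbb{R}^{n\times m}$ is the input matrix, $d_i=1$ if node $i$ is under control and $d_i=0$ otherwise, $H\in\mathbb{R}^{n\times n}$ is the inner coupling matrix, and $c_{ij}\in\mathbb{R}$ is the coupling strength, with $c_{ij}\ne0$ if there is a communication (edge) from node $j$ to node $i$ and $c_{ij}=0$ otherwise. Put $C=[c_{ij}]\in\mathbb{R}^{N\times N}$, $D=\mathrm{diag}\{d_1,\ldots,d_N\}$, $X=[x_1^T,\ldots,x_N^T]^T$, $U=[u_1^T,\ldots,u_N^T]^T$; the system then reads $\dot X=FX+GU$. "The networked system is controllable" means the pair $(F,G)$ is controllable. A pair $(M,K)$ with $M$ an $r\times r$ matrix and $K$ an $r\times s$ matrix is controllable if $[K,MK,\ldots,M^{r-1}K]$ has rank $r$ (equivalently, $\nu K\ne0$ for every, possibly complex,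 left eigenvector $\nu$ of $M$). $\otimes$ is the Kronecker product and $\mathrm{blockdiag}$ denotes a block diagonal matrix. *)

theory Defs
  imports "Jordan_Normal_Form.DL_Rank"
begin

text \<open>Indices are 0-based: row \<open>i * dim_row B + k\<close> of the Kronecker product is row \<open>k\<close> of its
  \<open>i\<close>-th block row, and similarly for columns.\<close>

definition kronecker :: "'a::semiring_0 mat \<Rightarrow> 'a mat \<Rightarrow> 'a mat" (infixl "\<otimes>\<^sub>K" 70) where
  "A \<otimes>\<^sub>K B = mat (dim_row A * dim_row B) (dim_col A * dim_col B)
     (\<lambda>(i, j). A $$ (i div dim_row B, j div dim_col B) * B $$ (i mod dim_row B, j mod dim_col B))"

text \<open>The block row \<open>[K, M K, \<dots>, M\<^sup>r\<^sup>-\<^sup>1 K]\<close> for \<open>r = dim_row M\<close>.\<close>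

definition controllability_mat :: "real mat \<Rightarrow> real mat \<Rightarrow> real mat" where
  "controllability_mat M K =
     mat_of_cols (dim_row M) (concat (map (\<lambda>k. cols (M ^\<^sub>m k * K)) [0..<dim_row M]))"

text \<open>Meaningful for square \<open>M\<close> and \<open>dim_row K = dim_row M\<close>. The argument of \<open>vec_space.rank\<close>
  is the dimension of the ambient column space.\<close>

definition controllable :: "real mat \<Rightarrow> real mat \<Rightarrow> bool" where
  "controllable M K \<longleftrightarrow> vec_space.rank (dim_row M) (controllability_mat M K) = dim_row M"

end

theory Submission
  imports Defs
begin

text \<open>A node without incoming edges evolves autonomously: its state obeys its own system
  \<open>(A j, B)\<close>, driven by its own input alone. Algebraically, let \<open>E\<close> be the block row that reads the
  state of node \<open>j\<close> off the network state. Since row \<open>j\<close> of \<open>C\<close> is zero, \<open>E F = A j E\<close> and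
  \<open>E G = B (d j E')\<close>, where \<open>E'\<close> selects the input of node \<open>j\<close>. Hence
  \<open>E F\<^sup>k G = (A j)\<^sup>k B (d j E')\<close> for all \<open>k\<close>.

  Failure of the rank condition means that some nonzero vector is orthogonal to all columns of the
  controllability matrix (\<open>not_controllable_iff\<close>). If \<open>v\<close> is such a vector for \<open>(A j, B)\<close>, then
  \<open>E\<^sup>T v\<close> is one for \<open>(F, G)\<close>, and it is nonzero because \<open>E\<^sup>T\<close> merely pads \<open>v\<close> with zeros.

  One gap remains: the controllability matrix of the network contains powers up to
  \<open>N n - 1\<close>, while the hypothesis on \<open>v\<close> reaches only power \<open>n - 1\<close>. The Cayley-Hamilton theorem
  would close it, but a linear dependence among the \<open>n + 1\<close> vectors \<open>((A j)\<^sup>T)\<^sup>k v\<close>, \<open>k \<le> n\<close>, is enough: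
  it turns every entry of \<open>((A j)\<^sup>k B)\<^sup>T v\<close> into a linear recurrence in \<open>k\<close> of order at most \<open>n\<close> with zero
  initial values (\<open>krylov_annihilated\<close>).\<close>

section \<open>Rank deficiency and orthogonal vectors\<close>

text \<open>Padding with zero rows gives a square matrix, singular because it has a zero row.\<close>

lemma wide_mat_kernel_nontrivial:
  fixes A :: "'a :: field mat"
  assumes A: "A \<in> carrier_mat nr nc" and less: "nr < nc"
  obtains v where "v \<in> carrier_vec nc" "v \<noteq> 0\<^sub>v nc" "A *\<^sub>v v = 0\<^sub>v nr"
proof -
  define P where "P = mat nc nc (\<lambda>(i, j). if i < nr then A $$ (i, j) else 0)"
  have P: "P \<in> carrier_mat nc nc" by (simp add: P_def)
  have "P = mat\<^sub>r nc nc (\<lambda>i. if i = nr then 0\<^sub>v nc else row P i)"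
    using less by (intro eq_matI) (auto simp: P_def)
  also have "det \<dots> = 0"
    by (rule det_row_0[OF less]) (use P in \<open>auto intro: row_carrier_vec\<close>)
  finally have "det P = 0" .
  then obtain v where v: "v \<in> carrier_vec nc" "v \<noteq> 0\<^sub>v nc" and Pv: "P *\<^sub>v v = 0\<^sub>v nc"
    using det_0_iff_vec_prod_zero_field[OF P] by auto
  have "A *\<^sub>v v = 0\<^sub>v nr"
  proof (rule eq_vecI)
    fix i assume "i < dim_vec (0\<^sub>v nr :: 'a vec)"
    then have i: "i < nr" by simp
    have "row A i = row P i" using i A less by (intro eq_vecI) (auto simp: P_def)
    then have "(A *\<^sub>v v) $ i = (P *\<^sub>v v) $ i" using i A P less by simp
    then show "(A *\<^sub>v v) $ i = 0\<^sub>v nr $ i" using Pv i less by simp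
  qed (use A in simp)
  with v show ?thesis by (rule that)
qed

text \<open>A maximal independent set \<open>S\<close> of columns spans all columns. If \<open>S\<close> has fewer than \<open>n\<close>
  elements, the matrix with rows \<open>S\<close> is wide, and a kernel vector of it is orthogonal to \<open>S\<close>. If \<open>S\<close>
  has \<open>n\<close> elements, it is a basis, so a vector orthogonal to \<open>S\<close> is orthogonal to the unit vectors
  and vanishes.\<close>

lemma (in vec_space) rank_deficient_iff:
  assumes M: "M \<in> carrier_mat n nc"
  shows "rank M \<noteq> n \<longleftrightarrow>
    (\<exists>v \<in> carrier_vec n. v \<noteq> 0\<^sub>v n \<and> (\<forall>c \<in> set (cols M). v \<bullet> c = 0))"
proof -
  have cols: "set (cols M) \<subseteq> carrier_vec n" using M cols_dim by blast
  obtain S where S: "maximal S (\<lambda>T. T \<subseteq> set (cols M) \<and> lin_indpt T)"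
    using maximal_exists[of "(\<lambda>T. T \<subseteq> set (cols M) \<and> lin_indpt T)" "card (set (cols M))" "{}"]
    by (meson List.finite_set card_mono empty_iff empty_subsetI finite_lin_indpt2 rev_finite_subset)
  then have sub: "S \<subseteq> set (cols M)" and indpt: "lin_indpt S"
    and max: "\<And>T. S \<subseteq> T \<Longrightarrow> T \<subseteq> set (cols M) \<Longrightarrow> lin_indpt T \<Longrightarrow> T = S"
    unfolding maximal_def by blast+
  have carr: "S \<subseteq> carrier_vec n" using sub cols by blast
  have fin: "finite S" using sub finite_subset by blast
  have rank: "rank M = card S" by (rule rank_card_indpt[OF M S])
  have span: "set (cols M) \<subseteq> span S"
  proof
    fix c assume c: "c \<in> set (cols M)"
    show "c \<in> span S"
    proof (rule ccontr)
      assume c_nin: "c \<notin> span S"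
      have "c \<in> carrier_vec n" "c \<notin> S" using c cols c_nin in_own_span[OF carr] by auto
      then have "lin_indpt (S \<union> {c})"
        using lin_dep_iff_in_span[of S c] carr indpt c_nin by auto
      with max[of "S \<union> {c}"] c sub \<open>c \<notin> S\<close> show False by blast
    qed
  qed
  show ?thesis
  proof
    assume "rank M \<noteq> n"
    then have less: "card S < n"
      using rank li_le_dim(2)[OF fin_dim _ indpt] carr by (simp add: dim_is_n)
    obtain xs where xs: "set xs = S" "distinct xs" using finite_distinct_list[OF fin] by blast
    then have len: "length xs = card S" using distinct_card by fastforce
    have "mat_of_rows n xs \<in> carrier_mat (card S) n" using len by auto
    then obtain v where v: "v \<in> carrier_vec n" "v \<noteq> 0\<^sub>v n"
      and ker: "mat_of_rows n xs *\<^sub>v v = 0\<^sub>v (card S)"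
      using wide_mat_kernel_nontrivial[OF _ less] by blast
    have "v \<in> orthogonal_complement S"
      unfolding orthogonal_complement_def
    proof (intro CollectI conjI ballI)
      fix y assume y: "y \<in> S"
      then obtain i where i: "i < length xs" "xs ! i = y" using xs by (metis in_set_conv_nth)
      have "(mat_of_rows n xs *\<^sub>v v) $ i = row (mat_of_rows n xs) i \<bullet> v" using i by simp
      also have "row (mat_of_rows n xs) i = y" using i y carr by auto
      finally have "y \<bullet> v = 0" using ker i len by simp
      then show "v \<bullet> y = 0" using comm_scalar_prod v(1) y carr by (metis subsetD)
    qed (rule v(1))
    then have "v \<in> orthogonal_complement (span S)" using carr by simp
    then show "\<exists>v \<in> carrier_vec n. v \<noteq> 0\<^sub>v n \<and> (\<forall>c \<in> set (cols M). v \<bullet> c = 0)"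
      using v span unfolding orthogonal_complement_def by blast
  next
    assume "\<exists>v \<in> carrier_vec n. v \<noteq> 0\<^sub>v n \<and> (\<forall>c \<in> set (cols M). v \<bullet> c = 0)"
    then obtain v where v: "v \<in> carrier_vec n" "v \<noteq> 0\<^sub>v n"
      and orth: "\<forall>c \<in> set (cols M). v \<bullet> c = 0" by blast
    show "rank M \<noteq> n"
    proof
      assume "rank M = n"
      then have "basis S"
        using dim_li_is_basis[OF fin_dim fin _ indpt] carr rank by (simp add: dim_is_n)
      then have "span S = carrier_vec n" by (simp add: basis_def)
      moreover have "v \<in> orthogonal_complement S"
        using v orth sub by (auto simp: orthogonal_complement_def)
      ultimately have "v \<in> orthogonal_complement (carrier_vec n)"
        using in_orthogonal_complement_span[OF carr] by simp
      then have "v \<bullet> unit_vec n i = 0" for i by (simp add: orthogonal_complement_def)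
      then have "v $ i = 0" if "i < n" for i
        using scalar_prod_right_unit[OF that, of v] by simp
      then have "v = 0\<^sub>v n" using v by auto
      with v(2) show False ..
    qed
  qed
qed

section \<open>Uncontrollable directions\<close>

lemma orthogonal_cols_iff:
  fixes X :: "'a :: comm_semiring_0 mat"
  assumes "X \<in> carrier_mat r s" "v \<in> carrier_vec r"
  shows "(\<forall>c \<in> set (cols X). v \<bullet> c = 0) \<longleftrightarrow> X\<^sup>T *\<^sub>v v = 0\<^sub>v s"
proof -
  have swap: "col X i \<bullet> v = v \<bullet> col X i" for i
  proof (rule comm_scalar_prod)
    show "col X i \<in> carrier_vec r"
      by (rule carrier_vecI) (simp only: dim_col carrier_matD(1)[OF assms(1)])
  qed (rule assms(2))
  have "X\<^sup>T *\<^sub>v v = vec s (\<lambda>i. v \<bullet> col X i)"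
  proof (rule eq_vecI)
    fix i assume "i < dim_vec (vec s (\<lambda>i. v \<bullet> col X i))"
    then have i: "i < s" by simp
    then have "(X\<^sup>T *\<^sub>v v) $ i = col X i \<bullet> v" using assms(1) by simp
    also have "\<dots> = v \<bullet> col X i" by (rule swap)
    finally show "(X\<^sup>T *\<^sub>v v) $ i = vec s (\<lambda>i. v \<bullet> col X i) $ i" using i by simp
  qed (use assms(1) in simp)
  moreover have "set (cols X) = col X ` {..<s}" using assms(1) by (auto simp: cols_def)
  moreover have "(vec s f = 0\<^sub>v s) \<longleftrightarrow> (\<forall>i<s. f i = 0)" for f :: "nat \<Rightarrow> 'a"
    by (simp add: vec_eq_iff)
  ultimately show ?thesis by (simp only: ball_simps lessThan_iff Ball_def image_iff) blast
qed

lemma not_controllable_iff: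
  assumes M: "M \<in> carrier_mat r r" and K: "K \<in> carrier_mat r s"
  shows "\<not> controllable M K \<longleftrightarrow>
    (\<exists>v \<in> carrier_vec r. v \<noteq> 0\<^sub>v r \<and> (\<forall>k<r. (M ^\<^sub>m k * K)\<^sup>T *\<^sub>v v = 0\<^sub>v s))"
proof -
  let ?cs = "concat (map (\<lambda>k. cols (M ^\<^sub>m k * K)) [0..<r])"
  have X: "M ^\<^sub>m k * K \<in> carrier_mat r s" for k using M K by (meson mult_carrier_mat pow_carrier_mat)
  have "set (cols (M ^\<^sub>m k * K)) \<subseteq> carrier_vec r" for k using X[of k] cols_dim by blast
  then have carr: "set ?cs \<subseteq> carrier_vec r" by auto
  have "controllability_mat M K = mat_of_cols r ?cs"
    using M by (simp add: controllability_mat_def)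
  then have "\<not> controllable M K \<longleftrightarrow> vec_space.rank r (mat_of_cols r ?cs) \<noteq> r"
    using M by (simp add: controllable_def)
  also have "\<dots> \<longleftrightarrow> (\<exists>v \<in> carrier_vec r. v \<noteq> 0\<^sub>v r \<and>
      (\<forall>c \<in> set (cols (mat_of_cols r ?cs)). v \<bullet> c = 0))"
    by (rule vec_space.rank_deficient_iff) (rule mat_of_cols_carrier)
  also have "cols (mat_of_cols r ?cs) = ?cs" by (rule cols_mat_of_cols[OF carr])
  also have "(\<exists>v \<in> carrier_vec r. v \<noteq> 0\<^sub>v r \<and> (\<forall>c \<in> set ?cs. v \<bullet> c = 0)) \<longleftrightarrow>
      (\<exists>v \<in> carrier_vec r. v \<noteq> 0\<^sub>v r \<and> (\<forall>k<r. \<forall>c \<in> set (cols (M ^\<^sub>m k * K)). v \<bullet> c = 0))"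
    by auto
  finally show ?thesis using orthogonal_cols_iff[OF X] by simp
qed

text \<open>The effective order of the recurrence is the largest index \<open>r \<le> n\<close> with \<open>c r \<noteq> 0\<close>: solving
  the relation at shift \<open>k - r\<close> for its last surviving term expresses \<open>g k\<close> through earlier values.
  The initial segment of \<open>n \<ge> r\<close> zeros therefore propagates.\<close>

lemma linear_recurrence_vanishes:
  fixes c :: "nat \<Rightarrow> 'a :: idom"
  assumes rec: "\<And>k. (\<Sum>i\<le>n. c i * g (k + i)) = 0"
    and nontrivial: "\<exists>i\<le>n. c i \<noteq> 0"
    and init: "\<And>k. k < n \<Longrightarrow> g k = 0"
  shows "g k = 0"
proof -
  define r where "r = Max {i. i \<le> n \<and> c i \<noteq> 0}"
  have fin: "finite {i. i \<le> n \<and> c i \<noteq> 0}" by simp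
  have "r \<in> {i. i \<le> n \<and> c i \<noteq> 0}" unfolding r_def by (rule Max_in[OF fin]) (use nontrivial in blast)
  then have r: "r \<le> n" "c r \<noteq> 0" by auto
  have above: "c i = 0" if "r < i" "i \<le> n" for i
  proof (rule ccontr)
    assume "c i \<noteq> 0"
    then have "i \<le> r" using that unfolding r_def by (intro Max_ge[OF fin]) simp
    with that show False by simp
  qed
  show ?thesis
  proof (induction k rule: less_induct)
    case (less k)
    show ?case
    proof (cases "k < n")
      case False
      have "c i * g (k - r + i) = 0" if "i \<in> {..n} - {r}" for i
      proof (cases "i < r")
        case True
        then show ?thesis using less[of "k - r + i"] False r by simp
      qed (use that above[of i] in auto)
      then have "(\<Sum>i\<le>n. c i * g (k - r + i)) = c r * g (k - r + r)"
        using r(1) by (subst sum.remove[of _ r]) (simp_all del: mult_eq_0_iff)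
      then show ?thesis using rec[of "k - r"] r False by simp
    qed (rule init)
  qed
qed

lemma pow_mat_split:
  assumes M: "M \<in> carrier_mat r r"
  shows "M ^\<^sub>m (k + l) = M ^\<^sub>m l * M ^\<^sub>m k"
proof (induction k)
  case 0
  then show ?case using right_mult_one_mat[OF pow_carrier_mat[OF M, of l]] M by simp
next
  case (Suc k)
  then show ?case
    using assoc_mult_mat[OF pow_carrier_mat[OF M, of l] pow_carrier_mat[OF M, of k] M] by simp
qed

text \<open>The conclusion extends the hypothesis from the powers below \<open>r\<close> to all powers. The matrix \<open>W\<close>
  has the \<open>r + 1\<close> Krylov vectors of \<open>M\<^sup>T\<close> as columns, so it has a nontrivial kernel vector \<open>c\<close>.
  Multiplying the dependence \<open>W c = 0\<close> by \<open>(M\<^sup>k K)\<^sup>T\<close> shifts all exponents by \<open>k\<close>, so the same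
  coefficients \<open>c\<close> give a recurrence valid at every \<open>k\<close>.\<close>

lemma krylov_annihilated:
  fixes M K :: "'a :: field mat"
  assumes M: "M \<in> carrier_mat r r" and K: "K \<in> carrier_mat r s" and v: "v \<in> carrier_vec r"
    and init: "\<And>k. k < r \<Longrightarrow> (M ^\<^sub>m k * K)\<^sup>T *\<^sub>v v = 0\<^sub>v s"
  shows "(M ^\<^sub>m k * K)\<^sup>T *\<^sub>v v = 0\<^sub>v s"
proof -
  have pow: "M ^\<^sub>m k \<in> carrier_mat r r" for k using M by (rule pow_carrier_mat)
  define W where "W = mat r (Suc r) (\<lambda>(i, l). ((M ^\<^sub>m l)\<^sup>T *\<^sub>v v) $ i)"
  have W: "W \<in> carrier_mat r (Suc r)" by (simp add: W_def)
  obtain c where c: "c \<in> carrier_vec (Suc r)" "c \<noteq> 0\<^sub>v (Suc r)" and Wc: "W *\<^sub>v c = 0\<^sub>v r"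
    using wide_mat_kernel_nontrivial[OF W] by blast
  define g where "g q k = ((M ^\<^sub>m k * K)\<^sup>T *\<^sub>v v) $ q" for q k
  have rec: "(\<Sum>l\<le>r. c $ l * g q (k + l)) = 0" if q: "q < s" for q k
  proof -
    have X: "M ^\<^sub>m k * K \<in> carrier_mat r s" using pow K by (rule mult_carrier_mat)
    have shift: "g q (k + l) = (((M ^\<^sub>m k * K)\<^sup>T * W) $$ (q, l))" if l: "l \<le> r" for l
    proof -
      have "M ^\<^sub>m (k + l) = M ^\<^sub>m l * M ^\<^sub>m k"
        by (rule pow_mat_split[OF M])
      then have "M ^\<^sub>m (k + l) * K = M ^\<^sub>m l * (M ^\<^sub>m k * K)"
        using assoc_mult_mat[OF pow pow K] by simp
      then have "(M ^\<^sub>m (k + l) * K)\<^sup>T = (M ^\<^sub>m k * K)\<^sup>T * (M ^\<^sub>m l)\<^sup>T"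
        using transpose_mult[OF pow X] by simp
      then have "(M ^\<^sub>m (k + l) * K)\<^sup>T *\<^sub>v v = (M ^\<^sub>m k * K)\<^sup>T *\<^sub>v ((M ^\<^sub>m l)\<^sup>T *\<^sub>v v)"
        using assoc_mult_mat_vec[of "(M ^\<^sub>m k * K)\<^sup>T" s r "(M ^\<^sub>m l)\<^sup>T" r v] X pow v by simp
      also have "(M ^\<^sub>m l)\<^sup>T *\<^sub>v v = col W l"
        using l pow[of l] v by (intro eq_vecI) (auto simp: W_def)
      finally have "g q (k + l) = row (M ^\<^sub>m k * K)\<^sup>T q \<bullet> col W l"
        using q carrier_matD(2)[OF X] by (simp add: g_def del: index_mult_mat)
      then show ?thesis using q l W carrier_matD(2)[OF X] by simp
    qed
    define Y where "Y = (M ^\<^sub>m k * K)\<^sup>T * W"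
    have Y: "Y \<in> carrier_mat s (Suc r)"
      unfolding Y_def by (rule mult_carrier_mat[of _ s r]) (use X W in auto)
    have "(\<Sum>l\<le>r. c $ l * g q (k + l)) = (\<Sum>l\<le>r. Y $$ (q, l) * c $ l)"
      by (intro sum.cong refl) (simp add: shift Y_def[symmetric] mult.commute)
    also have "\<dots> = (Y *\<^sub>v c) $ q"
      using q Y c(1) by (simp add: scalar_prod_def atLeast0LessThan lessThan_Suc_atMost)
    also have "Y *\<^sub>v c = (M ^\<^sub>m k * K)\<^sup>T *\<^sub>v (W *\<^sub>v c)"
      unfolding Y_def by (rule assoc_mult_mat_vec[of _ s r]) (use X W c in auto)
    also have "\<dots> = 0\<^sub>v s"
      unfolding Wc by (rule eq_vecI) (use X carrier_matD[OF X] in \<open>simp_all del: index_mult_mat\<close>)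
    finally show ?thesis using q by simp
  qed
  have nontrivial: "\<exists>l\<le>r. c $ l \<noteq> 0"
  proof (rule ccontr)
    assume "\<not> (\<exists>l\<le>r. c $ l \<noteq> 0)"
    then have "c = 0\<^sub>v (Suc r)" using c(1) by (intro eq_vecI) auto
    with c(2) show False ..
  qed
  have "g q k = 0" if q: "q < s" for q
    by (rule linear_recurrence_vanishes[OF rec[OF q] nontrivial]) (use init q in \<open>simp add: g_def\<close>)
  then show ?thesis using K M by (intro eq_vecI) (auto simp: g_def)
qed

text \<open>\<open>E\<close> and \<open>L\<close> map the states and inputs of \<open>(F, G)\<close> onto those of the subsystem \<open>(M, K)\<close>. A
  direction that the inputs never excite in the subsystem is pulled back by \<open>E\<^sup>T\<close>. As \<open>p\<close> may exceed
  \<open>r\<close>, powers of \<open>M\<close> beyond \<open>r - 1\<close> occur, which is where the Krylov argument is needed.\<close>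

lemma uncontrollable_lift:
  assumes M: "M \<in> carrier_mat r r" and K: "K \<in> carrier_mat r s"
    and F: "F \<in> carrier_mat p p" and G: "G \<in> carrier_mat p q"
    and E: "E \<in> carrier_mat r p" and L: "L \<in> carrier_mat s q"
    and EF: "E * F = M * E" and EG: "E * G = K * L"
    and inj: "\<And>v. v \<in> carrier_vec r \<Longrightarrow> E\<^sup>T *\<^sub>v v = 0\<^sub>v p \<Longrightarrow> v = 0\<^sub>v r"
    and unc: "\<not> controllable M K"
  shows "\<not> controllable F G"
proof -
  obtain v where v: "v \<in> carrier_vec r" "v \<noteq> 0\<^sub>v r"
    and ann: "\<And>k. k < r \<Longrightarrow> (M ^\<^sub>m k * K)\<^sup>T *\<^sub>v v = 0\<^sub>v s"
    using not_controllable_iff[OF M K] unc by auto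
  have powM: "M ^\<^sub>m k \<in> carrier_mat r r" for k using M by (rule pow_carrier_mat)
  have powF: "F ^\<^sub>m k \<in> carrier_mat p p" for k using F by (rule pow_carrier_mat)
  have pow: "E * F ^\<^sub>m k = M ^\<^sub>m k * E" for k
  proof (induction k)
    case 0 then show ?case using E F M by simp
  next
    case (Suc k)
    have "E * F ^\<^sub>m Suc k = (E * F ^\<^sub>m k) * F"
      using assoc_mult_mat[OF E powF F] by simp
    also have "\<dots> = M ^\<^sub>m k * (E * F)"
      using Suc assoc_mult_mat[OF powM E F] by simp
    also have "\<dots> = M ^\<^sub>m Suc k * E"
      using EF assoc_mult_mat[OF powM M E] by simp
    finally show ?case .
  qed
  have "(F ^\<^sub>m k * G)\<^sup>T *\<^sub>v (E\<^sup>T *\<^sub>v v) = 0\<^sub>v q" for k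
  proof -
    have FG: "F ^\<^sub>m k * G \<in> carrier_mat p q" using powF G by (rule mult_carrier_mat)
    have MK: "M ^\<^sub>m k * K \<in> carrier_mat r s" using powM K by (rule mult_carrier_mat)
    have "E * (F ^\<^sub>m k * G) = (M ^\<^sub>m k * E) * G"
      using assoc_mult_mat[OF E powF G] pow by simp
    also have "\<dots> = M ^\<^sub>m k * (K * L)" using assoc_mult_mat[OF powM E G] EG by simp
    also have "\<dots> = M ^\<^sub>m k * K * L" using assoc_mult_mat[OF powM K L] by simp
    finally have eq: "(F ^\<^sub>m k * G)\<^sup>T * E\<^sup>T = L\<^sup>T * (M ^\<^sub>m k * K)\<^sup>T"
      using transpose_mult[OF E FG] transpose_mult[OF MK L] by simp
    have "(F ^\<^sub>m k * G)\<^sup>T *\<^sub>v (E\<^sup>T *\<^sub>v v) = ((F ^\<^sub>m k * G)\<^sup>T * E\<^sup>T) *\<^sub>v v"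
      by (rule assoc_mult_mat_vec[symmetric, of _ q p _ r]) (use FG E v in auto)
    also have "\<dots> = L\<^sup>T *\<^sub>v ((M ^\<^sub>m k * K)\<^sup>T *\<^sub>v v)"
      unfolding eq by (rule assoc_mult_mat_vec[of _ q s _ r]) (use MK L v in auto)
    also have "\<dots> = 0\<^sub>v q"
      using krylov_annihilated[OF M K v(1) ann] L by auto
    finally show ?thesis .
  qed
  moreover have "E\<^sup>T *\<^sub>v v \<noteq> 0\<^sub>v p" using inj v by blast
  moreover have "E\<^sup>T *\<^sub>v v \<in> carrier_vec p" using E v by auto
  ultimately show ?thesis using not_controllable_iff[OF F G] by blast
qed

section \<open>Block rows\<close>

text \<open>The recursive description of a block diagonal matrix peels off one block at a time; for blocks
  of equal size the entries are given in closed form by the \<open>div\<close> and \<open>mod\<close> indexing that the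
  Kronecker product uses as well, so that the two can be added entrywise.\<close>

lemma diag_block_mat_index_uniform:
  assumes "\<And>i. i < N \<Longrightarrow> A i \<in> carrier_mat n n" and "p < N * n" "q < N * n"
  shows "diag_block_mat (map A [0..<N]) $$ (p, q) =
    (if p div n = q div n then A (p div n) $$ (p mod n, q mod n) else 0)"
  using assms
proof (induction N)
  case (Suc N)
  define D where "D = diag_block_mat (map A [0..<N])"
  have "map (dim_row \<circ> A) [0..<N] = map (\<lambda>_. n) [0..<N]"
    "map (dim_col \<circ> A) [0..<N] = map (\<lambda>_. n) [0..<N]"
    using carrier_matD[OF Suc.prems(1)] by auto
  then have dims: "dim_row D = N * n" "dim_col D = N * n"
    by (simp_all only: D_def dim_diag_block_mat map_map sum_list_triv length_upt diff_zero of_nat_id)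
  have A: "A N \<in> carrier_mat n n" using Suc.prems(1) by simp
  have "0 < n" using Suc.prems(2) by (cases n) auto
  have ge: "x div n = N \<and> x mod n = x - N * n" if x: "\<not> x < N * n" "x < Suc N * n" for x
  proof -
    have "x div n = N" by (rule div_nat_eqI) (use x in \<open>simp_all add: mult.commute\<close>)
    then show ?thesis using minus_div_mult_eq_mod[of x n] by simp
  qed
  have lt: "x div n < N" if "x < N * n" for x
    using that by (simp add: less_mult_imp_div_less)
  have "diag_block_mat (map A [0..<Suc N]) $$ (p, q) =
    (if p < N * n then if q < N * n then D $$ (p, q) else 0
     else if q < N * n then 0 else A N $$ (p - N * n, q - N * n))"
    using Suc.prems(2,3) A dims
    by (simp add: diag_block_mat_last Let_def D_def[symmetric])
  moreover have "D $$ (p, q) =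
      (if p div n = q div n then A (p div n) $$ (p mod n, q mod n) else 0)"
    if "p < N * n" "q < N * n"
    using Suc.IH[folded D_def] Suc.prems(1) that by simp
  ultimately show ?case
    using ge[OF _ Suc.prems(2)] ge[OF _ Suc.prems(3)] lt[of p] lt[of q]
    by (cases "p < N * n"; cases "q < N * n") simp_all
qed simp

text \<open>The Kronecker product of the \<open>j\<close>-th unit row vector of length \<open>N\<close> with the \<open>n \<times> n\<close>
  identity matrix. With the entries written out, left multiplication is a sum with a single
  nonzero term.\<close>

definition block_row :: "nat \<Rightarrow> nat \<Rightarrow> nat \<Rightarrow> real mat" where
  "block_row N n j = mat n (N * n) (\<lambda>(s, q). if q = j * n + s then 1 else 0)"

lemma block_index_less:
  fixes j N s n :: nat
  assumes "j < N" "s < n"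
  shows "j * n + s < N * n"
proof -
  have "j * n + s < Suc j * n" using assms(2) by simp
  also have "\<dots> \<le> N * n" using assms(1) by (intro mult_le_mono1) simp
  finally show ?thesis .
qed

lemma block_row_carrier [simp]: "block_row N n j \<in> carrier_mat n (N * n)"
  by (simp add: block_row_def)

lemma block_row_mult_index:
  assumes X: "X \<in> carrier_mat (N * n) c" and j: "j < N" and s: "s < n" and q: "q < c"
  shows "(block_row N n j * X) $$ (s, q) = X $$ (j * n + s, q)"
proof -
  have "(block_row N n j * X) $$ (s, q) =
      (\<Sum>p = 0..<N * n. (if p = j * n + s then 1 else 0) * X $$ (p, q))"
    using assms by (simp add: block_row_def scalar_prod_def)
  also have "\<dots> = (\<Sum>p = 0..<N * n. if p = j * n + s then X $$ (p, q) else 0)"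
    by (intro sum.cong) auto
  finally have "(block_row N n j * X) $$ (s, q) =
      (\<Sum>p = 0..<N * n. if p = j * n + s then X $$ (p, q) else 0)" .
  then show ?thesis using block_index_less[OF j s] by simp
qed

lemma mult_block_row_index:
  assumes X: "X \<in> carrier_mat r n" and s: "s < r" and q: "q < N * n"
  shows "(X * block_row N n j) $$ (s, q) = (if q div n = j then X $$ (s, q mod n) else 0)"
proof -
  have "0 < n" using q by (cases n) auto
  have "(X * block_row N n j) $$ (s, q) =
      (\<Sum>t = 0..<n. X $$ (s, t) * (if q = j * n + t then 1 else 0))"
    using assms by (auto simp: block_row_def scalar_prod_def intro!: sum.cong)
  also have "\<dots> = (\<Sum>t = 0..<n. if t = q mod n then if q div n = j then X $$ (s, t) else 0 else 0)"
    by (intro sum.cong) auto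
  finally show ?thesis using \<open>0 < n\<close> by simp
qed

lemma block_row_transpose_inj:
  assumes j: "j < N" and v: "v \<in> carrier_vec n"
    and ker: "(block_row N n j)\<^sup>T *\<^sub>v v = 0\<^sub>v (N * n)"
  shows "v = 0\<^sub>v n"
proof (rule eq_vecI)
  fix s assume "s < dim_vec (0\<^sub>v n :: real vec)"
  then have s: "s < n" by simp
  have "((block_row N n j)\<^sup>T *\<^sub>v v) $ (j * n + s) = (\<Sum>t = 0..<n. (if s = t then 1 else 0) * v $ t)"
    using block_index_less[OF j s] v by (simp add: block_row_def scalar_prod_def)
  also have "\<dots> = (\<Sum>t = 0..<n. if t = s then v $ t else 0)"
    by (intro sum.cong) auto
  also have "\<dots> = v $ s" using s by simp
  finally have "((block_row N n j)\<^sup>T *\<^sub>v v) $ (j * n + s) = v $ s" .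
  then show "v $ s = 0\<^sub>v n $ s" using ker block_index_less[OF j s] s by simp
qed (use v in simp)

section \<open>Nodes without incoming edges\<close>

theorem theorem4p4:
  fixes N n m j :: nat
    and A :: "nat \<Rightarrow> real mat"
    and B C H F G :: "real mat"
    and d :: "nat \<Rightarrow> real"
  assumes "\<And>i. i < N \<Longrightarrow> A i \<in> carrier_mat n n"
    and "B \<in> carrier_mat n m"
    and "H \<in> carrier_mat n n"
    and "C \<in> carrier_mat N N"
    and "\<And>i. i < N \<Longrightarrow> d i \<in> {0, 1}"
    and "F = diag_block_mat (map A [0..<N]) + C \<otimes>\<^sub>K H"
    and "G = mat_diag N d \<otimes>\<^sub>K B"
    and "j < N"
    and "row C j = 0\<^sub>v N"
    and "\<not> controllable (A j) B"
  shows "\<not> controllable F G"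
proof -
  note A = assms(1) and B = assms(2) and H = assms(3) and C = assms(4)
    and F_def = assms(6) and G_def = assms(7) and j = assms(8) and row = assms(9)
  have Aj: "A j \<in> carrier_mat n n" using A j by blast
  have F: "F \<in> carrier_mat (N * n) (N * n)" using C H by (auto simp: F_def kronecker_def)
  have G: "G \<in> carrier_mat (N * n) (N * m)" using B by (auto simp: G_def kronecker_def mat_diag_def)
  have Cj: "C $$ (j, i) = 0" if "i < N" for i
    using arg_cong[OF row, of "\<lambda>w. w $ i"] that C j by simp
  have L: "d j \<cdot>\<^sub>m block_row N m j \<in> carrier_mat m (N * m)" by simp
  have AE: "A j * block_row N n j \<in> carrier_mat n (N * n)"
    using Aj block_row_carrier by (rule mult_carrier_mat)
  \<comment> \<open>Rows of block \<open>j\<close> of \<open>F\<close> come from \<open>A j\<close> alone, as the coupling coefficients \<open>C $$ (j, i)\<close> vanish.\<close>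
  have EF: "block_row N n j * F = A j * block_row N n j"
  proof (rule eq_matI)
    fix s q assume "s < dim_row (A j * block_row N n j)" "q < dim_col (A j * block_row N n j)"
    then have s: "s < n" and q: "q < N * n" using AE by auto
    have p: "j * n + s < N * n" by (rule block_index_less[OF j s])
    have "q div n < N" using q by (simp add: less_mult_imp_div_less)
    then have "F $$ (j * n + s, q) = (if j = q div n then A j $$ (s, q mod n) else 0)"
      using diag_block_mat_index_uniform[OF A p q] p q s C H Cj
      by (simp add: F_def kronecker_def)
    then show "(block_row N n j * F) $$ (s, q) = (A j * block_row N n j) $$ (s, q)"
      using block_row_mult_index[OF F j s q] mult_block_row_index[OF Aj s q] by auto
  qed (use F Aj in \<open>auto simp: block_row_def\<close>)
  have BL: "B * (d j \<cdot>\<^sub>m block_row N m j) \<in> carrier_mat n (N * m)"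
    using B L by (rule mult_carrier_mat)
  \<comment> \<open>The scalar \<open>d j\<close> goes to the input side, so that a node without control needs no separate case.\<close>
  have EG: "block_row N n j * G = B * (d j \<cdot>\<^sub>m block_row N m j)"
  proof (rule eq_matI)
    fix s q assume "s < dim_row (B * (d j \<cdot>\<^sub>m block_row N m j))"
      "q < dim_col (B * (d j \<cdot>\<^sub>m block_row N m j))"
    then have s: "s < n" and q: "q < N * m" using BL by auto
    have p: "j * n + s < N * n" by (rule block_index_less[OF j s])
    have "q div m < N" using q by (simp add: less_mult_imp_div_less)
    then have "G $$ (j * n + s, q) = (if q div m = j then d j * B $$ (s, q mod m) else 0)"
      using p q s B j by (auto simp: G_def kronecker_def mat_diag_def)
    moreover have "B * (d j \<cdot>\<^sub>m block_row N m j) = d j \<cdot>\<^sub>m (B * block_row N m j)"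
      by (rule mult_smult_distrib[OF B block_row_carrier])
    moreover have "B * block_row N m j \<in> carrier_mat n (N * m)"
      using B block_row_carrier by (rule mult_carrier_mat)
    moreover note carrier_matD[OF this]
    ultimately show "(block_row N n j * G) $$ (s, q) = (B * (d j \<cdot>\<^sub>m block_row N m j)) $$ (s, q)"
      using block_row_mult_index[OF G j s q] mult_block_row_index[OF B s q] s q
      by (simp del: index_mult_mat)
  qed (use G B in \<open>auto simp: block_row_def\<close>)
  show ?thesis
    by (rule uncontrollable_lift[OF Aj B F G block_row_carrier L EF EG _ assms(10)])
      (rule block_row_transpose_inj[OF j])
qed

end
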